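(* Let $(\Xi,\rho',\theta',\Sigma')$ be a continuous groupoid action. There is a one-to-one correspondence between extensions $f:\Sigma\to\Sigma'$ of this action and continuous actions of the groupoid $\Xi\ltimes_{\theta'}\Sigma'$.
   Context: All topological spaces are Hausdorff. A groupoid $\Xi$ is a small category in which all arrows are invertible; $X=\Xi^{(0)}$ is its unit space, $d,r:\Xi\to X$ are the source and range maps, and $\xi\eta$ is defined iff $d(\xi)=r(\eta)$. A topological groupoid is a groupoid with a (Hausdorff) topology making inversion and multiplication continuous (composable pairs carry the topology induced from $\Xi\times\Xi$); $X$ has the subspace topology. For $x\in X$, $\Xi_x=d^{-1}(\{x\})$. A continuous groupoid action $(\Xi,\rho,\theta,\Sigma)$ consists of a topological groupoid $\Xi$, a Hausdorff space $\Sigma$, a continuous surjection $\rho:\Sigma\to X$ (the anchor) and a continuous map $\theta:\{(\xi,\sigma)\in\Xi\times\Sigma: d(\xi)=\rho(\sigma)\}\to\Sigma$, $\theta_\xi(\sigma)=\xi\bullet\sigma$, with $\rho(\sigma)\bullet\sigma=\sigma$ and: if $d(\xi)=r(\eta)$ and $d(\eta)=\rho(\sigma)$ then $d(\xi)=\rho(\eta\bullet\sigma)$ and $(\xi\eta)\bullet\sigma=\xi\bullet(\eta\bullet\sigma)$. An epimorphism from $(\Xi,\rho,\theta,\Sigma)$ to $(\Xi,\rho',\theta',\Sigma')$ is a continuous surjection $f:\Sigma\to\Sigma'$ with $\rho'(f(\sigma))=\rho(\sigma)$ and $f(\theta_\xi(\sigma))=\theta'_\xi(f(\sigma))$ for all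 $\sigma\in\Sigma$, $\xi\in\Xi_{\rho(\sigma)}$; then the first action is called an extension of the second. An extension $f:\Sigma\to\Sigma'$ means a continuous action $(\Xi,\rho,\theta,\Sigma)$ together with such an epimorphism $f$. The action (transformation, crossed product) groupoid $\Xi\ltimes_{\theta'}\Sigma'$ is the closed subspace $\{(\xi,\sigma')\in\Xi\times\Sigma':d(\xi)=\rho'(\sigma')\}$ of $\Xi\times\Sigma'$ with multiplication $(\eta,\theta'_\xi(\sigma'))(\xi,\sigma')=(\eta\xi,\sigma')$, inverse $(\xi,\sigma')^{-1}=(\xi^{-1},\theta'_\xi(\sigma'))$, source $(\xi,\sigma')\mapsto(\rho'(\sigma'),\sigma')\equiv\sigma'$ and range $(\xi,\sigma')\mapsto(r(\xi),\theta'_\xi(\sigma'))\equiv\theta'_\xi(\sigma')$; its unit space is identified with $\Sigma'$. *)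

theory Defs
  imports "HOL-Analysis.Analysis"
begin

text \<open>
  Groupoids here are one-sorted: the units are themselves arrows, and \<open>src\<close> and \<open>rng\<close> (the maps
  \<open>d\<close> and \<open>r\<close>) send an arrow to a unit. The set of arrows is the \<^const>\<open>topspace\<close> of the
  topology \<open>arr\<close>; \<open>mul \<xi> \<eta>\<close> is only meaningful if \<open>src \<xi> = rng \<eta>\<close>.
\<close>

record 'g groupoid =
  arr :: "'g topology"
  src :: "'g \<Rightarrow> 'g"
  rng :: "'g \<Rightarrow> 'g"
  mul :: "'g \<Rightarrow> 'g \<Rightarrow> 'g"
  ginv :: "'g \<Rightarrow> 'g"

definition arrows :: "'g groupoid \<Rightarrow> 'g set" where
  "arrows G = topspace (arr G)"

definition units :: "'g groupoid \<Rightarrow> 'g set" where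
  "units G = src G ` arrows G"

definition unit_space :: "'g groupoid \<Rightarrow> 'g topology" where
  "unit_space G = subtopology (arr G) (units G)"

definition composable :: "'g groupoid \<Rightarrow> ('g \<times> 'g) set" where
  "composable G = {(\<xi>, \<eta>). \<xi> \<in> arrows G \<and> \<eta> \<in> arrows G \<and> src G \<xi> = rng G \<eta>}"

locale groupoid =
  fixes G :: "'g groupoid"
  assumes src_closed: "\<xi> \<in> arrows G \<Longrightarrow> src G \<xi> \<in> arrows G"
    and rng_closed: "\<xi> \<in> arrows G \<Longrightarrow> rng G \<xi> \<in> arrows G"
    and src_src: "\<xi> \<in> arrows G \<Longrightarrow> src G (src G \<xi>) = src G \<xi>"
    and rng_src: "\<xi> \<in> arrows G \<Longrightarrow> rng G (src G \<xi>) = src G \<xi>"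
    and src_rng: "\<xi> \<in> arrows G \<Longrightarrow> src G (rng G \<xi>) = rng G \<xi>"
    and rng_rng: "\<xi> \<in> arrows G \<Longrightarrow> rng G (rng G \<xi>) = rng G \<xi>"
    and mul_closed: "(\<xi>, \<eta>) \<in> composable G \<Longrightarrow> mul G \<xi> \<eta> \<in> arrows G"
    and src_mul: "(\<xi>, \<eta>) \<in> composable G \<Longrightarrow> src G (mul G \<xi> \<eta>) = src G \<eta>"
    and rng_mul: "(\<xi>, \<eta>) \<in> composable G \<Longrightarrow> rng G (mul G \<xi> \<eta>) = rng G \<xi>"
    and mul_assoc: "(\<xi>, \<eta>) \<in> composable G \<Longrightarrow> (\<eta>, \<zeta>) \<in> composable G \<Longrightarrow>
      mul G (mul G \<xi> \<eta>) \<zeta> = mul G \<xi> (mul G \<eta> \<zeta>)"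
    and mul_src: "\<xi> \<in> arrows G \<Longrightarrow> mul G \<xi> (src G \<xi>) = \<xi>"
    and rng_mul_left: "\<xi> \<in> arrows G \<Longrightarrow> mul G (rng G \<xi>) \<xi> = \<xi>"
    and ginv_closed: "\<xi> \<in> arrows G \<Longrightarrow> ginv G \<xi> \<in> arrows G"
    and src_ginv: "\<xi> \<in> arrows G \<Longrightarrow> src G (ginv G \<xi>) = rng G \<xi>"
    and rng_ginv: "\<xi> \<in> arrows G \<Longrightarrow> rng G (ginv G \<xi>) = src G \<xi>"
    and ginv_mul: "\<xi> \<in> arrows G \<Longrightarrow> mul G (ginv G \<xi>) \<xi> = src G \<xi>"
    and mul_ginv: "\<xi> \<in> arrows G \<Longrightarrow> mul G \<xi> (ginv G \<xi>) = rng G \<xi>"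

locale topological_groupoid = groupoid G for G :: "'g groupoid" +
  assumes Hausdorff_arr: "Hausdorff_space (arr G)"
    and continuous_ginv: "continuous_map (arr G) (arr G) (ginv G)"
    and continuous_mul:
      "continuous_map (subtopology (prod_topology (arr G) (arr G)) (composable G)) (arr G)
        (\<lambda>(\<xi>, \<eta>). mul G \<xi> \<eta>)"

record ('g, 's) gaction =
  spc :: "'s topology"
  anchor :: "'s \<Rightarrow> 'g"
  act :: "'g \<Rightarrow> 's \<Rightarrow> 's"

definition points :: "('g, 's) gaction \<Rightarrow> 's set" where
  "points A = topspace (spc A)"

definition act_dom :: "'g groupoid \<Rightarrow> ('g, 's) gaction \<Rightarrow> ('g \<times> 's) set" where
  "act_dom G A = {(\<xi>, \<sigma>). \<xi> \<in> arrows G \<and> \<sigma> \<in> points A \<and> src G \<xi> = anchor A \<sigma>}"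

locale continuous_action = topological_groupoid G
  for G :: "'g groupoid" and A :: "('g, 's) gaction" +
  assumes Hausdorff_spc: "Hausdorff_space (spc A)"
    and continuous_anchor: "continuous_map (spc A) (unit_space G) (anchor A)"
    and anchor_surj: "anchor A ` points A = units G"
    and continuous_act:
      "continuous_map (subtopology (prod_topology (arr G) (spc A)) (act_dom G A)) (spc A)
        (\<lambda>(\<xi>, \<sigma>). act A \<xi> \<sigma>)"
    and act_unit: "\<sigma> \<in> points A \<Longrightarrow> act A (anchor A \<sigma>) \<sigma> = \<sigma>"
    and anchor_act: "(\<xi>, \<eta>) \<in> composable G \<Longrightarrow> (\<eta>, \<sigma>) \<in> act_dom G A \<Longrightarrow>
      src G \<xi> = anchor A (act A \<eta> \<sigma>)"
    and act_mul: "(\<xi>, \<eta>) \<in> composable G \<Longrightarrow> (\<eta>, \<sigma>) \<in> act_dom G A \<Longrightarrow>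
      act A (mul G \<xi> \<eta>) \<sigma> = act A \<xi> (act A \<eta> \<sigma>)"

definition epimorphism ::
    "'g groupoid \<Rightarrow> ('g, 's) gaction \<Rightarrow> ('g, 't) gaction \<Rightarrow> ('s \<Rightarrow> 't) \<Rightarrow> bool" where
  "epimorphism G A A' f \<longleftrightarrow>
     continuous_action G A \<and> continuous_action G A' \<and>
     continuous_map (spc A) (spc A') f \<and> f ` points A = points A' \<and>
     (\<forall>\<sigma>\<in>points A. anchor A' (f \<sigma>) = anchor A \<sigma>) \<and>
     (\<forall>(\<xi>, \<sigma>)\<in>act_dom G A. f (act A \<xi> \<sigma>) = act A' \<xi> (f \<sigma>))"

text \<open>
  Anchors, actions and epimorphisms are partial maps represented by total functions. To count each
  of them exactly once, the collections below contain only the representatives with value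
  \<^const>\<open>undefined\<close> outside the domain.
\<close>

definition normalized :: "'g groupoid \<Rightarrow> ('g, 's) gaction \<Rightarrow> bool" where
  "normalized G A \<longleftrightarrow>
     anchor A \<in> extensional (points A) \<and>
     (\<lambda>(\<xi>, \<sigma>). act A \<xi> \<sigma>) \<in> extensional (act_dom G A)"

definition continuous_actions :: "'g groupoid \<Rightarrow> ('g, 's) gaction set" where
  "continuous_actions G = {A. continuous_action G A \<and> normalized G A}"

definition extensions ::
    "'g groupoid \<Rightarrow> ('g, 't) gaction \<Rightarrow> (('g, 's) gaction \<times> ('s \<Rightarrow> 't)) set" where
  "extensions G A' =
     {(A, f). epimorphism G A A' f \<and> normalized G A \<and> f \<in> extensional (points A)}"

definition action_groupoid :: "'g groupoid \<Rightarrow> ('g, 't) gaction \<Rightarrow> ('g \<times> 't) groupoid" where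
  "action_groupoid G A' =
     \<lparr>arr = subtopology (prod_topology (arr G) (spc A')) (act_dom G A'),
      src = (\<lambda>(\<xi>, \<tau>). (anchor A' \<tau>, \<tau>)),
      rng = (\<lambda>(\<xi>, \<tau>). (rng G \<xi>, act A' \<xi> \<tau>)),
      mul = (\<lambda>(\<eta>, _) (\<xi>, \<tau>). (mul G \<eta> \<xi>, \<tau>)),
      ginv = (\<lambda>(\<xi>, \<tau>). (ginv G \<xi>, act A' \<xi> \<tau>))\<rparr>"

text \<open>
  The action of the action groupoid attached to an extension \<open>f\<close>: the anchor is \<open>f\<close>, followed by
  the identification \<open>\<tau> \<mapsto> (\<rho>'(\<tau>), \<tau>)\<close> of the base space with the unit space of the action
  groupoid, and \<open>(\<xi>, \<tau>) \<bullet> \<sigma> = \<theta>\<^sub>\<xi>(\<sigma>)\<close> for \<open>\<tau> = f(\<sigma>)\<close>.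
\<close>

definition action_of_extension ::
    "'g groupoid \<Rightarrow> ('g, 't) gaction \<Rightarrow> ('g, 's) gaction \<times> ('s \<Rightarrow> 't) \<Rightarrow> ('g \<times> 't, 's) gaction" where
  "action_of_extension G A' = (\<lambda>(A, f).
     \<lparr>spc = spc A,
      anchor = (\<lambda>\<sigma>\<in>points A. (anchor A' (f \<sigma>), f \<sigma>)),
      act = (\<lambda>(\<xi>, \<tau>) \<sigma>. if (\<xi>, \<sigma>) \<in> act_dom G A \<and> \<tau> = f \<sigma> then act A \<xi> \<sigma> else undefined)\<rparr>)"

end

theory Submission
  imports Defs
begin

text \<open>
  An action of \<open>H = \<Xi> \<ltimes> \<Sigma>'\<close> on \<open>\<Sigma>\<close> has an anchor \<open>\<Sigma> \<rightarrow> H\<^sup>(\<^sup>0\<^sup>) \<cong> \<Sigma>'\<close>, and this anchor is the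
  epimorphism \<open>f\<close>. The point is that an arrow \<open>(\<xi>, \<tau>)\<close> of \<open>H\<close> can act on \<open>\<sigma>\<close> only if \<open>\<tau> = f(\<sigma>)\<close>, so
  its second component carries no information: an action of \<open>H\<close> is a rule letting \<open>\<xi>\<close> act on \<open>\<sigma>\<close>
  whenever \<open>d(\<xi>) = \<rho>'(f(\<sigma>))\<close>. That is an action of \<open>\<Xi>\<close> with anchor \<open>\<rho>' \<circ> f\<close>. Under this
  translation, the axiom that \<open>h \<bullet> \<sigma>\<close> is anchored at the range of \<open>h = (\<xi>, f(\<sigma>))\<close>, namely at
  \<open>\<theta>'\<^sub>\<xi>(f(\<sigma>))\<close>, says exactly that \<open>f\<close> is equivariant, and surjectivity of the anchor says that \<open>f\<close>
  is onto.

  The inverse of the correspondence is therefore explicit (\<open>extension_of_action\<close>). The work lies in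
  checking that \<open>H\<close> is a topological groupoid and that both constructions preserve continuity. The
  continuity arguments for the operations have one form: a partially defined operation, continuous on its
  domain, is composed with continuous maps that land in that domain.
\<close>

section \<open>Partially defined continuous operations\<close>

lemma (in topological_groupoid) continuous_map_mul:
  assumes "continuous_map X (arr G) p" "continuous_map X (arr G) q"
    and "\<And>x. x \<in> topspace X \<Longrightarrow> (p x, q x) \<in> composable G"
  shows "continuous_map X (arr G) (\<lambda>x. mul G (p x) (q x))"
proof -
  have "continuous_map X (subtopology (prod_topology (arr G) (arr G)) (composable G)) (\<lambda>x. (p x, q x))"
    using assms by (auto simp: continuous_map_in_subtopology continuous_map_paired)
  from continuous_map_compose[OF this continuous_mul] show ?thesis
    by (simp add: o_def)
qed

lemma (in continuous_action) continuous_map_act: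
  assumes "continuous_map X (arr G) p" "continuous_map X (spc A) q"
    and "\<And>x. x \<in> topspace X \<Longrightarrow> (p x, q x) \<in> act_dom G A"
  shows "continuous_map X (spc A) (\<lambda>x. act A (p x) (q x))"
proof -
  have "continuous_map X (subtopology (prod_topology (arr G) (spc A)) (act_dom G A)) (\<lambda>x. (p x, q x))"
    using assms by (auto simp: continuous_map_in_subtopology continuous_map_paired)
  from continuous_map_compose[OF this continuous_act] show ?thesis
    by (simp add: o_def)
qed

section \<open>Elementary properties of actions\<close>

context groupoid
begin

lemma units_subset_arrows: "x \<in> units G \<Longrightarrow> x \<in> arrows G"
  by (auto simp: units_def src_closed)

lemma src_unit: "x \<in> units G \<Longrightarrow> src G x = x"
  by (auto simp: units_def src_src)

lemma rng_unit: "x \<in> units G \<Longrightarrow> rng G x = x"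
  by (auto simp: units_def rng_src)

lemma composable_rng: "\<xi> \<in> arrows G \<Longrightarrow> (rng G \<xi>, \<xi>) \<in> composable G"
  by (simp add: composable_def rng_closed src_rng)

end

context continuous_action
begin

lemma continuous_map_anchor_arr: "continuous_map (spc A) (arr G) (anchor A)"
  using continuous_anchor by (simp add: unit_space_def continuous_map_in_subtopology)

lemma anchor_unit: "\<sigma> \<in> points A \<Longrightarrow> anchor A \<sigma> \<in> units G"
  using anchor_surj by blast

lemma anchor_act_dom: "\<sigma> \<in> points A \<Longrightarrow> (anchor A \<sigma>, \<sigma>) \<in> act_dom G A"
  by (simp add: act_dom_def anchor_unit units_subset_arrows src_unit)

lemma act_closed: "(\<xi>, \<sigma>) \<in> act_dom G A \<Longrightarrow> act A \<xi> \<sigma> \<in> points A"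
  using continuous_map_image_subset_topspace[OF continuous_act]
  by (fastforce simp: act_dom_def arrows_def points_def)

text \<open>The axioms only compare the anchor of \<open>\<xi> \<bullet> \<sigma>\<close> with sources of composable arrows; composing
  with the unit \<open>r(\<xi>)\<close> turns this into a formula.\<close>
lemma anchor_act_eq: "(\<xi>, \<sigma>) \<in> act_dom G A \<Longrightarrow> anchor A (act A \<xi> \<sigma>) = rng G \<xi>"
  using anchor_act[OF composable_rng] by (auto simp: act_dom_def src_rng)

end

text \<open>That formula in turn implies the axiom, and an anchor with the right image is continuous into the
  unit space as soon as it is continuous into the space of arrows.\<close>
lemma (in topological_groupoid) continuous_actionI:
  assumes "Hausdorff_space (spc A)"
    and "continuous_map (spc A) (arr G) (anchor A)"
    and "anchor A ` points A = units G"
    and "continuous_map (subtopology (prod_topology (arr G) (spc A)) (act_dom G A)) (spc A)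
          (\<lambda>x. act A (fst x) (snd x))"
    and "\<And>\<sigma>. \<sigma> \<in> points A \<Longrightarrow> act A (anchor A \<sigma>) \<sigma> = \<sigma>"
    and "\<And>\<xi> \<sigma>. (\<xi>, \<sigma>) \<in> act_dom G A \<Longrightarrow> anchor A (act A \<xi> \<sigma>) = rng G \<xi>"
    and "\<And>\<xi> \<eta> \<sigma>. (\<xi>, \<eta>) \<in> composable G \<Longrightarrow> (\<eta>, \<sigma>) \<in> act_dom G A \<Longrightarrow>
          act A (mul G \<xi> \<eta>) \<sigma> = act A \<xi> (act A \<eta> \<sigma>)"
  shows "continuous_action G A"
proof unfold_locales
  show "continuous_map (spc A) (unit_space G) (anchor A)"
    using assms(2,3) by (auto simp: unit_space_def continuous_map_in_subtopology points_def)
  show "continuous_map (subtopology (prod_topology (arr G) (spc A)) (act_dom G A)) (spc A)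
          (\<lambda>(\<xi>, \<sigma>). act A \<xi> \<sigma>)"
    using assms(4) by (simp add: case_prod_unfold)
qed (use assms in \<open>auto simp: composable_def\<close>)

section \<open>The action groupoid\<close>

lemma action_groupoid_simps [simp]:
  "arr (action_groupoid G A') = subtopology (prod_topology (arr G) (spc A')) (act_dom G A')"
  "src (action_groupoid G A') (\<xi>, \<tau>) = (anchor A' \<tau>, \<tau>)"
  "rng (action_groupoid G A') (\<xi>, \<tau>) = (rng G \<xi>, act A' \<xi> \<tau>)"
  "mul (action_groupoid G A') (\<eta>, \<upsilon>) (\<xi>, \<tau>) = (mul G \<eta> \<xi>, \<tau>)"
  "ginv (action_groupoid G A') (\<xi>, \<tau>) = (ginv G \<xi>, act A' \<xi> \<tau>)"
  by (simp_all add: action_groupoid_def)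

lemma arrows_action_groupoid: "arrows (action_groupoid G A') = act_dom G A'"
  by (auto simp: arrows_def act_dom_def points_def)

context continuous_action
begin

lemma composable_action_groupoid_iff:
  "((\<eta>, \<upsilon>), (\<xi>, \<tau>)) \<in> composable (action_groupoid G A) \<longleftrightarrow>
    (\<eta>, \<xi>) \<in> composable G \<and> (\<xi>, \<tau>) \<in> act_dom G A \<and> \<upsilon> = act A \<xi> \<tau>"
  by (auto simp: composable_def arrows_action_groupoid)
     (auto simp: act_dom_def anchor_act_eq act_closed)

text \<open>This is the identification of the unit space with the space acted upon.\<close>
lemma units_action_groupoid: "units (action_groupoid G A) = (\<lambda>\<tau>. (anchor A \<tau>, \<tau>)) ` points A"
proof -
  have "snd ` act_dom G A = points A"
    using anchor_act_dom by (force simp: act_dom_def)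
  moreover have "src (action_groupoid G A) ` act_dom G A = (\<lambda>\<tau>. (anchor A \<tau>, \<tau>)) ` snd ` act_dom G A"
    by (force simp: image_image)
  ultimately show ?thesis
    by (simp add: units_def arrows_action_groupoid)
qed

lemma mul_act_dom:
  "(\<eta>, \<xi>) \<in> composable G \<Longrightarrow> (\<xi>, \<tau>) \<in> act_dom G A \<Longrightarrow> (mul G \<eta> \<xi>, \<tau>) \<in> act_dom G A"
  by (simp add: act_dom_def mul_closed src_mul)

lemma ginv_act_dom: "(\<xi>, \<tau>) \<in> act_dom G A \<Longrightarrow> (ginv G \<xi>, act A \<xi> \<tau>) \<in> act_dom G A"
  using act_closed[of \<xi> \<tau>] anchor_act_eq[of \<xi> \<tau>] by (simp add: act_dom_def ginv_closed src_ginv)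

lemma rng_act_dom: "(\<xi>, \<tau>) \<in> act_dom G A \<Longrightarrow> (rng G \<xi>, act A \<xi> \<tau>) \<in> act_dom G A"
  using act_closed[of \<xi> \<tau>] anchor_act_eq[of \<xi> \<tau>] by (simp add: act_dom_def rng_closed src_rng)

lemma act_ginv: "(\<xi>, \<tau>) \<in> act_dom G A \<Longrightarrow> act A (ginv G \<xi>) (act A \<xi> \<tau>) = \<tau>"
  using act_mul[of "ginv G \<xi>" \<xi> \<tau>]
  by (auto simp: act_dom_def composable_def ginv_closed src_ginv ginv_mul act_unit)

lemma act_rng: "(\<xi>, \<tau>) \<in> act_dom G A \<Longrightarrow> act A (rng G \<xi>) (act A \<xi> \<tau>) = act A \<xi> \<tau>"
  using act_unit[OF act_closed] by (simp add: anchor_act_eq)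

lemma groupoid_action_groupoid: "groupoid (action_groupoid G A)"
proof
  fix \<alpha> assume \<alpha>: "\<alpha> \<in> arrows (action_groupoid G A)"
  obtain \<xi> \<tau> where [simp]: "\<alpha> = (\<xi>, \<tau>)" by fastforce
  have dom: "(\<xi>, \<tau>) \<in> act_dom G A"
    using \<alpha> by (simp add: arrows_action_groupoid)
  then have [simp]: "\<xi> \<in> arrows G" "\<tau> \<in> points A" and src: "anchor A \<tau> = src G \<xi>"
    by (simp_all add: act_dom_def)
  let ?H = "action_groupoid G A"
  show "src ?H \<alpha> \<in> arrows ?H" by (simp add: arrows_action_groupoid anchor_act_dom)
  show "rng ?H \<alpha> \<in> arrows ?H" using dom by (simp add: arrows_action_groupoid rng_act_dom)
  show "ginv ?H \<alpha> \<in> arrows ?H" using dom by (simp add: arrows_action_groupoid ginv_act_dom)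
  show "src ?H (src ?H \<alpha>) = src ?H \<alpha>" by simp
  show "rng ?H (src ?H \<alpha>) = src ?H \<alpha>" by (simp add: anchor_unit rng_unit act_unit)
  show "src ?H (rng ?H \<alpha>) = rng ?H \<alpha>" using dom by (simp add: anchor_act_eq)
  show "rng ?H (rng ?H \<alpha>) = rng ?H \<alpha>" using dom by (simp add: rng_rng act_rng)
  show "mul ?H \<alpha> (src ?H \<alpha>) = \<alpha>" by (simp add: src mul_src)
  show "mul ?H (rng ?H \<alpha>) \<alpha> = \<alpha>" by (simp add: rng_mul_left)
  show "src ?H (ginv ?H \<alpha>) = rng ?H \<alpha>" using dom by (simp add: anchor_act_eq)
  show "rng ?H (ginv ?H \<alpha>) = src ?H \<alpha>" using dom by (simp add: rng_ginv src act_ginv)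
  show "mul ?H (ginv ?H \<alpha>) \<alpha> = src ?H \<alpha>" by (simp add: ginv_mul src)
  show "mul ?H \<alpha> (ginv ?H \<alpha>) = rng ?H \<alpha>" by (simp add: mul_ginv)
next
  fix \<alpha> \<beta> assume comp: "(\<alpha>, \<beta>) \<in> composable (action_groupoid G A)"
  obtain \<eta> \<upsilon> \<xi> \<tau> where [simp]: "\<alpha> = (\<eta>, \<upsilon>)" "\<beta> = (\<xi>, \<tau>)" by fastforce
  have c: "(\<eta>, \<xi>) \<in> composable G" "(\<xi>, \<tau>) \<in> act_dom G A" "\<upsilon> = act A \<xi> \<tau>"
    using comp by (simp_all add: composable_action_groupoid_iff)
  let ?H = "action_groupoid G A"
  show "mul ?H \<alpha> \<beta> \<in> arrows ?H" using c by (simp add: arrows_action_groupoid mul_act_dom)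
  show "src ?H (mul ?H \<alpha> \<beta>) = src ?H \<beta>" by simp
  show "rng ?H (mul ?H \<alpha> \<beta>) = rng ?H \<alpha>" using c by (simp add: rng_mul act_mul)
  fix \<gamma> assume comp': "(\<beta>, \<gamma>) \<in> composable (action_groupoid G A)"
  obtain \<zeta> \<phi> where [simp]: "\<gamma> = (\<zeta>, \<phi>)" by fastforce
  show "mul ?H (mul ?H \<alpha> \<beta>) \<gamma> = mul ?H \<alpha> (mul ?H \<beta> \<gamma>)"
    using comp' c by (simp add: composable_action_groupoid_iff mul_assoc)
qed

lemma continuous_map_into_action_groupoid:
  "continuous_map X (arr (action_groupoid G A)) (\<lambda>x. (p x, q x)) \<longleftrightarrow>
    continuous_map X (arr G) p \<and> continuous_map X (spc A) q \<and>
    (\<forall>x\<in>topspace X. (p x, q x) \<in> act_dom G A)"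
  by (auto simp: continuous_map_in_subtopology continuous_map_paired)

lemma continuous_map_fst_action_groupoid:
  "continuous_map X (arr (action_groupoid G A)) p \<Longrightarrow> continuous_map X (arr G) (\<lambda>x. fst (p x))"
  and continuous_map_snd_action_groupoid:
  "continuous_map X (arr (action_groupoid G A)) p \<Longrightarrow> continuous_map X (spc A) (\<lambda>x. snd (p x))"
  by (simp_all add: continuous_map_in_subtopology continuous_map_pairwise o_def)

text \<open>Inversion and multiplication of the action groupoid are assembled from those of the groupoid and
  from the action, so that their continuity is inherited.\<close>
lemma topological_groupoid_action_groupoid: "topological_groupoid (action_groupoid G A)"
proof -
  let ?H = "action_groupoid G A"
  interpret H: groupoid ?H by (rule groupoid_action_groupoid)
  have fst_snd: "continuous_map (arr ?H) (arr G) fst" "continuous_map (arr ?H) (spc A) snd"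
    using continuous_map_fst_action_groupoid[of "arr ?H" id]
      continuous_map_snd_action_groupoid[of "arr ?H" id] by simp_all
  have dom: "x \<in> act_dom G A" if "x \<in> topspace (arr ?H)" for x
    using that by simp
  show ?thesis
  proof
    show "Hausdorff_space (arr ?H)"
      by (simp add: Hausdorff_space_subtopology Hausdorff_space_prod_topology Hausdorff_arr Hausdorff_spc)
    have "continuous_map (arr ?H) (arr ?H) (\<lambda>x. (ginv G (fst x), act A (fst x) (snd x)))"
      unfolding continuous_map_into_action_groupoid
    proof (intro conjI ballI)
      show "continuous_map (arr ?H) (arr G) (\<lambda>x. ginv G (fst x))"
        using continuous_map_compose[OF fst_snd(1) continuous_ginv] by (simp add: o_def)
      show "continuous_map (arr ?H) (spc A) (\<lambda>x. act A (fst x) (snd x))"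
        using fst_snd dom by (intro continuous_map_act) auto
      show "(ginv G (fst x), act A (fst x) (snd x)) \<in> act_dom G A" if "x \<in> topspace (arr ?H)" for x
        using dom[OF that] by (cases x) (simp add: ginv_act_dom)
    qed
    then show "continuous_map (arr ?H) (arr ?H) (ginv ?H)"
      by (rule continuous_map_eq) auto
    let ?P = "subtopology (prod_topology (arr ?H) (arr ?H)) (composable ?H)"
    have P: "continuous_map ?P (arr ?H) fst" "continuous_map ?P (arr ?H) snd"
      by (intro continuous_map_from_subtopology continuous_map_fst continuous_map_snd)+
    have comp: "(fst (fst x), fst (snd x)) \<in> composable G \<and> snd x \<in> act_dom G A"
      if "x \<in> topspace ?P" for x
    proof -
      have "x \<in> composable ?H" using that by simp
      then show ?thesis
        by (cases x rule: prod.exhaust, cases "fst x", cases "snd x")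
          (auto simp: composable_action_groupoid_iff)
    qed
    have "continuous_map ?P (arr ?H) (\<lambda>x. (mul G (fst (fst x)) (fst (snd x)), snd (snd x)))"
      unfolding continuous_map_into_action_groupoid
    proof (intro conjI ballI)
      show "continuous_map ?P (arr G) (\<lambda>x. mul G (fst (fst x)) (fst (snd x)))"
        using P comp by (intro continuous_map_mul continuous_map_fst_action_groupoid) auto
      show "continuous_map ?P (spc A) (\<lambda>x. snd (snd x))"
        using P by (intro continuous_map_snd_action_groupoid)
      show "(mul G (fst (fst x)) (fst (snd x)), snd (snd x)) \<in> act_dom G A"
        if "x \<in> topspace ?P" for x
        using comp[OF that] by (intro mul_act_dom) auto
    qed
    then show "continuous_map ?P (arr ?H) (\<lambda>(\<xi>, \<eta>). mul ?H \<xi> \<eta>)"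
      by (rule continuous_map_eq) auto
  qed
qed

end

section \<open>From extensions to actions of the action groupoid\<close>

lemma act_dom_action_of_extension_iff:
  assumes "epimorphism G A A' f"
  shows "((\<xi>, \<tau>), \<sigma>) \<in> act_dom (action_groupoid G A') (action_of_extension G A' (A, f)) \<longleftrightarrow>
    (\<xi>, \<sigma>) \<in> act_dom G A \<and> \<tau> = f \<sigma>"
  using assms
  by (auto simp: act_dom_def arrows_action_groupoid action_of_extension_def points_def epimorphism_def
      Pi_iff continuous_map_def)

text \<open>On the domain the second component of an arrow is \<open>f(\<sigma>)\<close>, so each axiom reduces to the one for
  the given action; equivariance of \<open>f\<close> is what keeps the second components composable.\<close>
lemma continuous_action_of_extension:
  assumes epi: "epimorphism G A A' f"
  shows "continuous_action (action_groupoid G A') (action_of_extension G A' (A, f))"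
proof -
  let ?H = "action_groupoid G A'" and ?B = "action_of_extension G A' (A, f)"
  interpret A: continuous_action G A using epi by (simp add: epimorphism_def)
  interpret A': continuous_action G A' using epi by (simp add: epimorphism_def)
  interpret H: topological_groupoid ?H by (rule A'.topological_groupoid_action_groupoid)
  have f: "continuous_map (spc A) (spc A') f" "f ` points A = points A'"
    and anchor_f: "\<And>\<sigma>. \<sigma> \<in> points A \<Longrightarrow> anchor A' (f \<sigma>) = anchor A \<sigma>"
    and act_f: "\<And>\<xi> \<sigma>. (\<xi>, \<sigma>) \<in> act_dom G A \<Longrightarrow> f (act A \<xi> \<sigma>) = act A' \<xi> (f \<sigma>)"
    using epi by (auto simp: epimorphism_def)
  note dom_iff = act_dom_action_of_extension_iff[OF epi]
  have spc: "spc ?B = spc A" and points: "points ?B = points A"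
    by (simp_all add: action_of_extension_def points_def)
  have anchor: "anchor ?B \<sigma> = (anchor A' (f \<sigma>), f \<sigma>)" if "\<sigma> \<in> points A" for \<sigma>
    using that by (simp add: action_of_extension_def)
  have act: "act ?B (\<xi>, f \<sigma>) \<sigma> = act A \<xi> \<sigma>" if "(\<xi>, \<sigma>) \<in> act_dom G A" for \<xi> \<sigma>
    using that by (simp add: action_of_extension_def)
  show ?thesis
  proof (rule H.continuous_actionI)
    show "Hausdorff_space (spc ?B)" by (simp add: spc A.Hausdorff_spc)
    have "continuous_map (spc A) (arr ?H) (\<lambda>\<sigma>. (anchor A' (f \<sigma>), f \<sigma>))"
      unfolding A'.continuous_map_into_action_groupoid
      using continuous_map_compose[OF f(1) A'.continuous_map_anchor_arr] f A'.anchor_act_dom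
      by (auto simp: o_def points_def)
    then show "continuous_map (spc ?B) (arr ?H) (anchor ?B)"
      unfolding spc by (rule continuous_map_eq) (simp add: anchor points_def)
    show "anchor ?B ` points ?B = units ?H"
      by (simp add: A'.units_action_groupoid points anchor f(2)[symmetric] image_image)
    let ?X = "subtopology (prod_topology (arr ?H) (spc ?B)) (act_dom ?H ?B)"
    have X: "(fst (fst x), snd x) \<in> act_dom G A \<and> snd (fst x) = f (snd x)"
      if "x \<in> topspace ?X" for x
      using that dom_iff[of "fst (fst x)" "snd (fst x)" "snd x"] by simp
    have "continuous_map ?X (spc A) (\<lambda>x. act A (fst (fst x)) (snd x))"
    proof (rule A.continuous_map_act)
      show "continuous_map ?X (arr G) (\<lambda>x. fst (fst x))"
        by (intro A'.continuous_map_fst_action_groupoid continuous_map_from_subtopology continuous_map_fst)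
      show "continuous_map ?X (spc A) snd"
        unfolding spc by (intro continuous_map_from_subtopology continuous_map_snd)
    qed (use X in blast)
    then show "continuous_map ?X (spc ?B) (\<lambda>x. act ?B (fst x) (snd x))"
      unfolding spc
    proof (rule continuous_map_eq)
      fix x assume "x \<in> topspace (subtopology (prod_topology (arr ?H) (spc A)) (act_dom ?H ?B))"
      then show "act A (fst (fst x)) (snd x) = act ?B (fst x) (snd x)"
        using X[of x] act[of "fst (fst x)" "snd x"] by (metis spc prod.collapse)
    qed
    show "act ?B (anchor ?B \<sigma>) \<sigma> = \<sigma>" if "\<sigma> \<in> points ?B" for \<sigma>
      using that by (simp add: points anchor act anchor_f A.act_unit A.anchor_act_dom)
    show "anchor ?B (act ?B \<alpha> \<sigma>) = rng ?H \<alpha>" if \<alpha>\<sigma>: "(\<alpha>, \<sigma>) \<in> act_dom ?H ?B" for \<alpha> \<sigma>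
    proof -
      obtain \<xi> where \<alpha>: "\<alpha> = (\<xi>, f \<sigma>)" and dom: "(\<xi>, \<sigma>) \<in> act_dom G A"
        using \<alpha>\<sigma> dom_iff by (cases \<alpha>) auto
      show ?thesis
        using A.anchor_act_eq[OF dom] act_f[OF dom] anchor_f[OF A.act_closed[OF dom]]
        by (simp add: \<alpha> act dom anchor A.act_closed)
    qed
    show "act ?B (mul ?H \<alpha> \<beta>) \<sigma> = act ?B \<alpha> (act ?B \<beta> \<sigma>)"
      if comp: "(\<alpha>, \<beta>) \<in> composable ?H" and \<beta>\<sigma>: "(\<beta>, \<sigma>) \<in> act_dom ?H ?B" for \<alpha> \<beta> \<sigma>
    proof -
      obtain \<xi> where \<beta>: "\<beta> = (\<xi>, f \<sigma>)" and dom: "(\<xi>, \<sigma>) \<in> act_dom G A"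
        using \<beta>\<sigma> dom_iff by (cases \<beta>) auto
      obtain \<eta> where \<alpha>: "\<alpha> = (\<eta>, f (act A \<xi> \<sigma>))" and comp': "(\<eta>, \<xi>) \<in> composable G"
        using comp act_f[OF dom] by (cases \<alpha>) (auto simp: \<beta> A'.composable_action_groupoid_iff)
      have "(\<eta>, act A \<xi> \<sigma>) \<in> act_dom G A"
        using comp' dom A.act_closed A.anchor_act_eq by (auto simp: act_dom_def composable_def)
      then show ?thesis
        using A.act_mul[OF comp' dom] A.mul_act_dom[OF comp' dom] by (simp add: \<alpha> \<beta> act dom)
    qed
  qed
qed

lemma normalized_action_of_extension:
  assumes "epimorphism G A A' f"
  shows "normalized (action_groupoid G A') (action_of_extension G A' (A, f))"
  unfolding normalized_def
proof
  show "anchor (action_of_extension G A' (A, f))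
      \<in> extensional (points (action_of_extension G A' (A, f)))"
    by (simp add: action_of_extension_def points_def)
  have "act (action_of_extension G A' (A, f)) \<alpha> \<sigma> = undefined"
    if "(\<alpha>, \<sigma>) \<notin> act_dom (action_groupoid G A') (action_of_extension G A' (A, f))" for \<alpha> \<sigma>
    using that act_dom_action_of_extension_iff[OF assms]
    by (cases \<alpha>) (auto simp: action_of_extension_def)
  then show "(\<lambda>(\<xi>, \<sigma>). act (action_of_extension G A' (A, f)) \<xi> \<sigma>)
      \<in> extensional (act_dom (action_groupoid G A') (action_of_extension G A' (A, f)))"
    by (auto simp: extensional_def)
qed

section \<open>From actions of the action groupoid to extensions\<close>

definition epi_of_action :: "('g \<times> 't, 's) gaction \<Rightarrow> 's \<Rightarrow> 't" where
  "epi_of_action B = (\<lambda>\<sigma>\<in>points B. snd (anchor B \<sigma>))"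

text \<open>The case distinction in the action is the domain of the action of the base groupoid, spelled out
  because that domain refers to the anchor being defined.\<close>
definition action_below :: "'g groupoid \<Rightarrow> ('g \<times> 't, 's) gaction \<Rightarrow> ('g, 's) gaction" where
  "action_below G B =
     \<lparr>spc = spc B,
      anchor = (\<lambda>\<sigma>\<in>points B. fst (anchor B \<sigma>)),
      act = (\<lambda>\<xi> \<sigma>. if \<xi> \<in> arrows G \<and> \<sigma> \<in> points B \<and> src G \<xi> = fst (anchor B \<sigma>)
                   then act B (\<xi>, snd (anchor B \<sigma>)) \<sigma> else undefined)\<rparr>"

definition extension_of_action ::
    "'g groupoid \<Rightarrow> ('g \<times> 't, 's) gaction \<Rightarrow> ('g, 's) gaction \<times> ('s \<Rightarrow> 't)" where
  "extension_of_action G B = (action_below G B, epi_of_action B)"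

lemma action_below_simps:
  "spc (action_below G B) = spc B"
  "points (action_below G B) = points B"
  "\<sigma> \<in> points B \<Longrightarrow> anchor (action_below G B) \<sigma> = fst (anchor B \<sigma>)"
  "\<sigma> \<in> points B \<Longrightarrow> epi_of_action B \<sigma> = snd (anchor B \<sigma>)"
  "(\<xi>, \<sigma>) \<in> act_dom G (action_below G B) \<Longrightarrow>
    act (action_below G B) \<xi> \<sigma> = act B (\<xi>, epi_of_action B \<sigma>) \<sigma>"
  by (auto simp: action_below_def epi_of_action_def points_def act_dom_def)

lemma normalized_action_below: "normalized G (action_below G B)"
  by (auto simp: normalized_def action_below_def points_def extensional_def act_dom_def)

locale action_groupoid_action =
  base: continuous_action G A' + total: continuous_action "action_groupoid G A'" B
  for G :: "'g groupoid" and A' :: "('g, 't) gaction" and B :: "('g \<times> 't, 's) gaction"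
begin

abbreviation H where "H \<equiv> action_groupoid G A'"
abbreviation A where "A \<equiv> action_below G B"
abbreviation f where "f \<equiv> epi_of_action B"

lemma anchor_eq:
  assumes "\<sigma> \<in> points B"
  shows "f \<sigma> \<in> points A'" "anchor A \<sigma> = anchor A' (f \<sigma>)" "anchor B \<sigma> = (anchor A' (f \<sigma>), f \<sigma>)"
  using total.anchor_unit[OF assms] assms
  by (auto simp: base.units_action_groupoid action_below_simps)

lemma f_surj: "f ` points B = points A'"
proof -
  have "f ` points B = snd ` anchor B ` points B"
    by (simp add: image_image action_below_simps)
  then show ?thesis
    by (simp add: total.anchor_surj base.units_action_groupoid image_image)
qed

text \<open>No information is lost by forgetting the second component of an arrow that acts on \<open>\<sigma>\<close>.\<close>
lemma act_dom_iff:
  "((\<xi>, \<tau>), \<sigma>) \<in> act_dom H B \<longleftrightarrow> (\<xi>, \<sigma>) \<in> act_dom G A \<and> \<tau> = f \<sigma>"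
  using anchor_eq[of \<sigma>] by (auto simp: act_dom_def arrows_action_groupoid action_below_simps(2))

lemma f_act:
  assumes "(\<xi>, \<sigma>) \<in> act_dom G A"
  shows "act A \<xi> \<sigma> \<in> points B" "f (act A \<xi> \<sigma>) = act A' \<xi> (f \<sigma>)" "anchor A (act A \<xi> \<sigma>) = rng G \<xi>"
proof -
  have dom: "((\<xi>, f \<sigma>), \<sigma>) \<in> act_dom H B" using assms by (simp add: act_dom_iff)
  show pts: "act A \<xi> \<sigma> \<in> points B"
    using total.act_closed[OF dom] by (simp add: action_below_simps assms)
  \<comment> \<open>Equivariance of \<open>f\<close> is the second component of the anchor axiom of \<open>B\<close>, and the anchor axiom
    of \<open>A\<close> is the first.\<close>
  show "f (act A \<xi> \<sigma>) = act A' \<xi> (f \<sigma>)" "anchor A (act A \<xi> \<sigma>) = rng G \<xi>"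
    using total.anchor_act_eq[OF dom] anchor_eq[OF pts] by (auto simp: action_below_simps(5)[OF assms])
qed

lemma continuous_map_f: "continuous_map (spc B) (spc A') f"
  using base.continuous_map_snd_action_groupoid[OF total.continuous_map_anchor_arr]
  by (rule continuous_map_eq) (simp add: action_below_simps points_def)

text \<open>Every axiom is that of \<open>B\<close> for the arrow \<open>(\<xi>, f(\<sigma>))\<close>; continuity holds because this arrow depends
  continuously on \<open>(\<xi>, \<sigma>)\<close>.\<close>
lemma continuous_action_below: "continuous_action G A"
proof (rule base.continuous_actionI)
  show "Hausdorff_space (spc A)"
    by (simp add: action_below_simps total.Hausdorff_spc)
  have "continuous_map (spc B) (arr G) (\<lambda>\<sigma>. fst (anchor B \<sigma>))"
    by (rule base.continuous_map_fst_action_groupoid[OF total.continuous_map_anchor_arr])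
  then show "continuous_map (spc A) (arr G) (anchor A)"
    unfolding action_below_simps by (rule continuous_map_eq) (simp add: action_below_simps points_def)
  have "anchor A ` points A = anchor A' ` f ` points B"
    by (simp add: action_below_simps(2) anchor_eq(2) image_image)
  then show "anchor A ` points A = units G"
    by (simp add: f_surj base.anchor_surj)
  let ?X = "subtopology (prod_topology (arr G) (spc A)) (act_dom G A)"
  have proj: "continuous_map ?X (arr G) fst" "continuous_map ?X (spc B) snd"
    using action_below_simps(1)[of G B]
    by (metis continuous_map_from_subtopology continuous_map_fst continuous_map_snd)+
  have dom: "((fst x, f (snd x)), snd x) \<in> act_dom H B" if "x \<in> topspace ?X" for x
    using that by (simp add: act_dom_iff)
  have "continuous_map ?X (spc B) (\<lambda>x. act B (fst x, f (snd x)) (snd x))"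
  proof (rule total.continuous_map_act[OF _ proj(2) dom])
    show "continuous_map ?X (arr H) (\<lambda>x. (fst x, f (snd x)))"
      unfolding base.continuous_map_into_action_groupoid
      using proj(1) continuous_map_compose[OF proj(2) continuous_map_f] dom
      by (auto simp: o_def act_dom_def arrows_action_groupoid)
  qed
  then have "continuous_map ?X (spc B) (\<lambda>x. act A (fst x) (snd x))"
    by (rule continuous_map_eq) (simp add: action_below_simps(5))
  then show "continuous_map ?X (spc A) (\<lambda>x. act A (fst x) (snd x))"
    by (simp only: action_below_simps(1))
  show "act A (anchor A \<sigma>) \<sigma> = \<sigma>" if "\<sigma> \<in> points A" for \<sigma>
  proof -
    have \<sigma>: "\<sigma> \<in> points B" using that by (simp add: action_below_simps)
    then have "((anchor A \<sigma>, f \<sigma>), \<sigma>) \<in> act_dom H B"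
      using total.anchor_act_dom[OF \<sigma>] anchor_eq[OF \<sigma>] by simp
    then show ?thesis
      using total.act_unit[OF \<sigma>] anchor_eq[OF \<sigma>] by (simp add: act_dom_iff action_below_simps(5))
  qed
  show "anchor A (act A \<xi> \<sigma>) = rng G \<xi>" if "(\<xi>, \<sigma>) \<in> act_dom G A" for \<xi> \<sigma>
    using that by (rule f_act)
  show "act A (mul G \<xi> \<eta>) \<sigma> = act A \<xi> (act A \<eta> \<sigma>)"
    if comp: "(\<xi>, \<eta>) \<in> composable G" and dom: "(\<eta>, \<sigma>) \<in> act_dom G A" for \<xi> \<eta> \<sigma>
  proof -
    have domB: "((\<eta>, f \<sigma>), \<sigma>) \<in> act_dom H B" using dom by (simp add: act_dom_iff)
    have "((\<xi>, f (act A \<eta> \<sigma>)), (\<eta>, f \<sigma>)) \<in> composable H"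
      using comp domB f_act(2)[OF dom]
      by (simp add: base.composable_action_groupoid_iff act_dom_def arrows_action_groupoid)
    then have "act B (mul G \<xi> \<eta>, f \<sigma>) \<sigma> = act B (\<xi>, f (act A \<eta> \<sigma>)) (act A \<eta> \<sigma>)"
      using total.act_mul[of "(\<xi>, f (act A \<eta> \<sigma>))", OF _ domB] by (simp add: action_below_simps(5)[OF dom])
    moreover have "(mul G \<xi> \<eta>, \<sigma>) \<in> act_dom G A"
      using comp dom by (simp add: act_dom_def base.mul_closed base.src_mul)
    moreover have "(\<xi>, act A \<eta> \<sigma>) \<in> act_dom G A"
      using comp f_act[OF dom] by (simp add: act_dom_def composable_def action_below_simps(2))
    ultimately show ?thesis by (simp add: action_below_simps(5))
  qed
qed

lemma epimorphism_below: "epimorphism G A A' f"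
  unfolding epimorphism_def
  using continuous_action_below base.continuous_action_axioms continuous_map_f f_surj
    anchor_eq(2) f_act(2)
  by (auto simp: action_below_simps(1,2))

text \<open>Off their domains both sides agree because normalized maps take the default value there, and
  the two domains coincide.\<close>
lemma action_of_extension_of_action:
  assumes "normalized H B"
  shows "action_of_extension G A' (extension_of_action G B) = B"
proof -
  have "(\<lambda>\<sigma>\<in>points A. (anchor A' (f \<sigma>), f \<sigma>)) = anchor B"
    using assms
    by (auto simp: normalized_def action_below_simps(2) anchor_eq(3) fun_eq_iff restrict_def extensional_def)
  moreover have "(if (\<xi>, \<sigma>) \<in> act_dom G A \<and> \<tau> = f \<sigma> then act A \<xi> \<sigma> else undefined) = act B (\<xi>, \<tau>) \<sigma>"
    for \<xi> \<tau> \<sigma>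
  proof (cases "((\<xi>, \<tau>), \<sigma>) \<in> act_dom H B")
    case True
    then show ?thesis by (auto simp: act_dom_iff action_below_simps(5))
  next
    case False
    then have "act B (\<xi>, \<tau>) \<sigma> = undefined"
      using assms by (fastforce simp: normalized_def extensional_def)
    then show ?thesis using False by (auto simp: act_dom_iff)
  qed
  ultimately show ?thesis
    by (simp add: action_of_extension_def extension_of_action_def action_below_simps(1) fun_eq_iff
        gaction.equality)
qed

end

section \<open>The correspondence\<close>

lemma extension_of_action_of_extension:
  assumes "(A, f) \<in> extensions G A'"
  shows "extension_of_action G (action_of_extension G A' (A, f)) = (A, f)"
proof -
  let ?B = "action_of_extension G A' (A, f)"
  have epi: "epimorphism G A A' f" and norm: "normalized G A" and f_ext: "f \<in> extensional (points A)"
    using assms by (auto simp: extensions_def)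
  have points: "points ?B = points A" by (simp add: action_of_extension_def points_def)
  have anchor: "anchor ?B \<sigma> = (anchor A \<sigma>, f \<sigma>)" if "\<sigma> \<in> points A" for \<sigma>
    using that epi by (simp add: action_of_extension_def epimorphism_def)
  have "epi_of_action ?B = f"
    using f_ext by (auto simp: epi_of_action_def points anchor extensional_def fun_eq_iff)
  moreover have "action_below G ?B = A"
  proof (rule gaction.equality)
    show "spc (action_below G ?B) = spc A"
      by (simp add: action_below_def action_of_extension_def)
    show "anchor (action_below G ?B) = anchor A"
      using norm
      by (auto simp: action_below_def points anchor normalized_def extensional_def fun_eq_iff)
    show "act (action_below G ?B) = act A"
    proof (intro ext)
      fix \<xi> \<sigma>
      show "act (action_below G ?B) \<xi> \<sigma> = act A \<xi> \<sigma>"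
      proof (cases "(\<xi>, \<sigma>) \<in> act_dom G A")
        case True
        then have "act (action_below G ?B) \<xi> \<sigma> = act ?B (\<xi>, f \<sigma>) \<sigma>"
          by (simp add: action_below_def points anchor act_dom_def)
        also have "\<dots> = act A \<xi> \<sigma>" using True by (simp add: action_of_extension_def)
        finally show ?thesis .
      next
        case False
        then have "act (action_below G ?B) \<xi> \<sigma> = undefined"
          by (auto simp: action_below_def points anchor act_dom_def)
        moreover have "act A \<xi> \<sigma> = undefined"
          using False norm by (fastforce simp: normalized_def extensional_def)
        ultimately show ?thesis by simp
      qed
    qed
  qed simp
  ultimately show ?thesis by (simp add: extension_of_action_def)
qed

theorem proposition7p11:
  fixes G :: "'g groupoid" and A' :: "('g, 't) gaction"
  assumes "continuous_action G A'"
  shows "bij_betw (action_of_extension G A')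
    (extensions G A' :: (('g, 's) gaction \<times> ('s \<Rightarrow> 't)) set)
    (continuous_actions (action_groupoid G A') :: ('g \<times> 't, 's) gaction set)"
proof (rule bij_betw_byWitness[where f' = "extension_of_action G"])
  have act: "action_groupoid_action G A' B" if "B \<in> continuous_actions (action_groupoid G A')"
    for B :: "('g \<times> 't, 's) gaction"
    using assms that by (simp add: action_groupoid_action_def continuous_actions_def)
  show "\<forall>E\<in>extensions G A'. extension_of_action G (action_of_extension G A' E) = E"
    by (auto simp: extension_of_action_of_extension)
  show "\<forall>B\<in>continuous_actions (action_groupoid G A') :: ('g \<times> 't, 's) gaction set.
      action_of_extension G A' (extension_of_action G B) = B"
    using action_groupoid_action.action_of_extension_of_action[OF act]
    by (auto simp: continuous_actions_def)
  show "action_of_extension G A' ` extensions G A' \<subseteq> continuous_actions (action_groupoid G A')"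
    by (auto simp: extensions_def continuous_actions_def continuous_action_of_extension
        normalized_action_of_extension)
  show "extension_of_action G ` (continuous_actions (action_groupoid G A') :: ('g \<times> 't, 's) gaction set)
      \<subseteq> extensions G A'"
    using action_groupoid_action.epimorphism_below[OF act]
    by (auto simp: extensions_def extension_of_action_def normalized_action_below epi_of_action_def
        action_below_simps(2))
qed

end
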